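(* Let $A$ be a finite local ring with unit group $U(A)$, and let $n \geq 1$. Then \[r_{n}(A)=\frac{|A|^{n}-\sum_{u \in U(A)} w_{n+2}^{u}(A)}{|A\setminus U(A)|}.\] Moreover, if $n$ is odd, then $r_{n}(A)=\dfrac{|A|^{n}-|U(A)|\,w_{n+2}^{1_{A}}(A)}{|A\setminus U(A)|}$.
   Context: For a commutative unitary ring $A$, the continuants are defined by $K_{-1}:=0_A$, $K_0:=1_A$, and for $i\ge1$, $K_i(X_1,\dots,X_i)$ is the determinant of the $i\times i$ tridiagonal matrix with diagonal $X_1,\dots,X_i$ and all entries on the sub- and super-diagonal equal to $1_A$; equivalently $K_n(X_1,\dots,X_n)=X_nK_{n-1}(X_1,\dots,X_{n-1})-K_{n-2}(X_1,\dots,X_{n-2})$. For $a\in A$, $R_{n}^{a}(A):=\{(a_{1},\ldots,a_{n}) \in A^{n} : K_{n}(a_{1},\ldots,a_{n})=a\}$ and $r_{n}(A):=|R_{n}^{0_{A}}(A)|$ (the number of roots of the $n$-th continuant). Set $M_{n}(a_1,\ldots,a_n):=\begin{pmatrix} a_{n} & -1_{A} \\ 1_{A} & 0_{A}\end{pmatrix}\cdots\begin{pmatrix} a_{1} & -1_{A} \\ 1_{A} & 0_{A}\end{pmatrix}$, and for $u\in U(A)$ let $w_{n}^{u}(A)$ be the number of $(a_1,\dots,a_n)\in A^n$ with $M_n(a_1,\dots,a_n)=\begin{pmatrix} u & 0_A\\ 0_A & u^{-1}\end{pmatrix}$. *)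

theory Defs
  imports "HOL-Library.Cardinality" "HOL-Algebra.Algebraic_Closure_Type" "Jordan_Normal_Form.Determinant"
begin

text \<open>
  The ring A is the type \<open>'a :: comm_ring_1\<close>, and an n-tuple over A is a list of length n: the
  entry written \<open>a_i\<close> (with i counted from 1) is \<open>as ! (i - 1)\<close>.
\<close>

definition local_ring :: "'a::comm_ring_1 itself \<Rightarrow> bool" where
  "local_ring _ \<longleftrightarrow> (\<exists>!\<mm>. maximalideal \<mm> (ring_of_type_algebra :: 'a ring))"

definition unit_group :: "'a::comm_ring_1 set" where
  "unit_group = {u. u dvd 1}"

definition unit_inv :: "'a::comm_ring_1 \<Rightarrow> 'a" where
  "unit_inv u = (THE v. u * v = 1)"

definition tuples :: "nat \<Rightarrow> 'a list set" where
  "tuples n = {as. length as = n}"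

text \<open>
  The length of the list is the index of the continuant. The empty list gives the determinant of the
  0 by 0 matrix, which is 1. The conventional value 0 at index -1 has no counterpart here.
\<close>

definition continuant :: "'a::comm_ring_1 list \<Rightarrow> 'a" where
  "continuant as = det (mat (length as) (length as)
     (\<lambda>(i, j). if i = j then as ! i else if i = Suc j \<or> j = Suc i then 1 else 0))"

definition continuant_fibre :: "nat \<Rightarrow> 'a::comm_ring_1 \<Rightarrow> 'a list set" where
  "continuant_fibre n a = {as \<in> tuples n. continuant as = a}"

definition num_roots :: "'a::comm_ring_1 itself \<Rightarrow> nat \<Rightarrow> nat" where
  "num_roots _ n = card (continuant_fibre n (0::'a))"

text \<open>The factor belonging to the first entry of the list is the rightmost one.\<close>

fun cont_mat :: "'a::comm_ring_1 list \<Rightarrow> 'a mat" where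
  "cont_mat [] = 1\<^sub>m 2"
| "cont_mat (a # as) = cont_mat as * mat_of_rows_list 2 [[a, - 1], [1, 0]]"

definition num_diag :: "nat \<Rightarrow> 'a::comm_ring_1 \<Rightarrow> nat" where
  "num_diag n u =
     card {as \<in> tuples n. cont_mat as = mat_of_rows_list 2 [[u, 0], [0, unit_inv u]]}"

end

theory Submission
  imports Defs
begin

text \<open>
  The first row of \<open>M_n(a_1, \<dots>, a_n)\<close> is \<open>(K_n(a_1, \<dots>, a_n), -K_{n-1}(a_2, \<dots>, a_n))\<close>, and its
  determinant is 1; so in a local ring, if \<open>K_n(a_1, \<dots>, a_n)\<close> is not a unit, then
  \<open>K_{n-1}(a_2, \<dots>, a_n)\<close> is one. In that case \<open>K_n\<close> is an affine bijection in \<open>a_1\<close>, hence all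
  non-units have equally large fibres under \<open>K_n\<close>. On the other hand, completing an n-tuple on both
  sides so that the matrix \<open>M_{n+2}\<close> becomes \<open>diag(u, u\<^sup>-\<^sup>1)\<close> is possible, and then in a unique way,
  exactly when \<open>K_n = -u\<^sup>-\<^sup>1\<close>. Summing the sizes of all fibres gives \<open>|A|^n\<close>. For odd n,
  multiplying the entries alternately by \<open>\<lambda>\<close> and \<open>\<lambda>\<^sup>-\<^sup>1\<close> multiplies \<open>K_n\<close> by \<open>\<lambda>\<close>, so that
  the fibres over units also have the same size.
\<close>

section \<open>Units and local rings\<close>

lemma (in cring) ideal_subset_maximalideal:
  assumes I: "ideal I R" and proper: "I \<noteq> carrier R"
  obtains M where "maximalideal M R" "I \<subseteq> M"
proof -
  define S where "S = {J. ideal J R \<and> I \<subseteq> J \<and> \<one> \<notin> J}"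
  have "I \<in> S"
    using I proper ideal.one_imp_carrier[OF I] by (auto simp: S_def)
  have "\<Union>C \<in> S" if "C \<noteq> {}" and chain: "subset.chain S C" for C
  proof -
    have "subset.chain {J. ideal J R} C"
      using chain by (auto simp: S_def subset_chain_def)
    then have "ideal (\<Union>C) R"
      using chain_Union_is_ideal[of C] \<open>C \<noteq> {}\<close> by simp
    then show ?thesis
      using chain \<open>C \<noteq> {}\<close> by (auto simp: S_def subset_chain_def)
  qed
  then obtain M where "M \<in> S" and maximal: "\<And>J. J \<in> S \<Longrightarrow> M \<subseteq> J \<Longrightarrow> J = M"
    using subset_Zorn_nonempty[of S] \<open>I \<in> S\<close> by blast
  have "maximalideal M R"
  proof (rule maximalidealI)
    show "ideal M R" "carrier R \<noteq> M"
      using \<open>M \<in> S\<close> by (auto simp: S_def)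
  next
    fix J assume "ideal J R" "M \<subseteq> J"
    then show "J = M \<or> J = carrier R"
      using maximal[of J] \<open>M \<in> S\<close> ideal.one_imp_carrier[of J R] by (auto simp: S_def)
  qed
  then show thesis
    using that \<open>M \<in> S\<close> by (auto simp: S_def)
qed

lemma (in cring) nonunit_in_maximalideal:
  assumes "x \<in> carrier R" "x \<notin> Units R"
  obtains M where "maximalideal M R" "x \<in> M"
proof -
  have "ideal (PIdl x) R" "PIdl x \<noteq> carrier R" "x \<in> PIdl x"
    using assms cgenideal_ideal cgenideal_self ideal_eq_carrier_iff[of x] by auto
  then show thesis
    using ideal_subset_maximalideal[of "PIdl x"] that by blast
qed

lemma (in cring) maximalideal_Units_disjoint:
  assumes "maximalideal M R"
  shows "M \<inter> Units R = {}"
proof -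
  interpret M: maximalideal M R by fact
  have "x \<notin> Units R" if "x \<in> M" for x
  proof -
    have "PIdl x \<subseteq> M"
      using M.is_ideal that by (rule cgenideal_minimal)
    then show ?thesis
      using M.I_notcarr M.Icarr[OF that] M.a_subset ideal_eq_carrier_iff[of x] by blast
  qed
  then show ?thesis by blast
qed

lemma (in cring) nonunits_add_closed:
  assumes local: "\<exists>!M. maximalideal M R"
    and x: "x \<in> carrier R" "x \<notin> Units R" and y: "y \<in> carrier R" "y \<notin> Units R"
  shows "x \<oplus> y \<notin> Units R"
proof -
  obtain M where M: "maximalideal M R" "x \<in> M" "y \<in> M"
    using nonunit_in_maximalideal[OF x] nonunit_in_maximalideal[OF y] local by metis
  then interpret M: maximalideal M R by simp
  have "x \<oplus> y \<in> M"
    using M(2,3) by (rule M.a_closed)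
  then show ?thesis
    using maximalideal_Units_disjoint[OF M(1)] by blast
qed

lemma Units_ring_of_type_algebra: "Units ring_of_type_algebra = {u::'a::comm_ring_1. u dvd 1}"
  by (auto simp: Units_def ring_of_type_algebra_def dvd_def mult.commute)

lemma local_ring_nonunits_add:
  fixes x y :: "'a::comm_ring_1"
  assumes "local_ring TYPE('a)" "\<not> x dvd 1" "\<not> y dvd 1"
  shows "\<not> x + y dvd 1"
  using cring.nonunits_add_closed[OF cring_from_type_algebra, of x y] assms
  unfolding local_ring_def Units_ring_of_type_algebra by (simp add: ring_of_type_algebra_def)

lemma unit_mult_eq_iff:
  fixes u :: "'a::comm_monoid_mult"
  assumes "u * v = 1"
  shows "x * u = y \<longleftrightarrow> x = y * v"
proof
  assume "x * u = y"
  then have "y * v = x * (u * v)" by (auto simp: mult.assoc)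
  then show "x = y * v" by (simp add: assms)
next
  assume "x = y * v"
  then have "x * u = y * (u * v)" by (simp add: ac_simps)
  then show "x * u = y" by (simp add: assms)
qed

lemma unit_inv_unique:
  fixes u :: "'a::comm_ring_1"
  assumes "u * v = 1"
  shows "unit_inv u = v"
  unfolding unit_inv_def
  using assms unit_mult_eq_iff[OF assms, of _ 1] by (auto simp: mult.commute)

lemma unit_inv_right:
  fixes u :: "'a::comm_ring_1"
  assumes "u dvd 1"
  shows "u * unit_inv u = 1"
  using assms unit_inv_unique by (metis dvdE)

section \<open>Continuants as matrix entries\<close>

abbreviation mat22 :: "'a \<Rightarrow> 'a \<Rightarrow> 'a \<Rightarrow> 'a \<Rightarrow> 'a mat" where
  "mat22 a b c d \<equiv> mat_of_rows_list 2 [[a, b], [c, d]]"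

lemma mat22_carrier [simp]: "mat22 a b c d \<in> carrier_mat 2 2"
  by (rule carrier_matI) (simp_all add: mat_of_rows_list_def)

lemma mat22_index [simplified, simp]:
  "mat22 a b c d $$ (0, 0) = a" "mat22 a b c d $$ (0, 1) = b"
  "mat22 a b c d $$ (1, 0) = c" "mat22 a b c d $$ (1, 1) = d"
  by (simp_all add: mat_of_rows_list_def)

lemma mat22_cases:
  assumes "A \<in> carrier_mat 2 2"
  obtains a b c d where "A = mat22 a b c d"
proof
  show "A = mat22 (A $$ (0, 0)) (A $$ (0, 1)) (A $$ (1, 0)) (A $$ (1, 1))"
    using assms by (intro eq_matI) (auto simp: mat_of_rows_list_def less_Suc_eq numeral_2_eq_2)
qed

lemma mat22_eq_iff [simp]:
  "mat22 a b c d = mat22 a' b' c' d' \<longleftrightarrow> a = a' \<and> b = b' \<and> c = c' \<and> d = d'"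
  by (metis mat22_index)

lemma mat22_mult [simp]:
  fixes a :: "'a::semiring_0"
  shows "mat22 a b c d * mat22 a' b' c' d' =
    mat22 (a * a' + b * c') (a * b' + b * d') (c * a' + d * c') (c * b' + d * d')"
  by (rule eq_matI)
    (auto simp: mat_of_rows_list_def scalar_prod_def less_Suc_eq numeral_2_eq_2)

lemma det_mat22:
  fixes a :: "'a::comm_ring_1"
  shows "det (mat22 a b c d) = a * d - b * c"
proof -
  let ?A = "mat22 a b c d"
  have "det (mat_delete ?A i 0) = mat_delete ?A i 0 $$ (0, 0)" for i
    by (rule det_single) (simp add: mat_delete_def mat_of_rows_list_def)
  then show ?thesis
    by (subst laplace_expansion_column[OF mat22_carrier, of 0])
      (simp_all add: numeral_2_eq_2 cofactor_def mat_delete_def mat_of_rows_list_def algebra_simps)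
qed

lemma cont_mat_carrier [simp]: "cont_mat as \<in> carrier_mat 2 2"
  by (induction as) (auto intro: mult_carrier_mat)

lemma det_cont_mat: "det (cont_mat as) = 1"
proof (induction as)
  case (Cons a as)
  then show ?case by (simp add: det_mult[of _ 2] det_mat22)
qed simp

lemma cont_mat_snoc: "cont_mat (as @ [a]) = mat22 a (- 1) 1 0 * cont_mat as"
proof (induction as)
  case Nil
  show ?case by (simp add: left_mult_one_mat[OF mat22_carrier] right_mult_one_mat[OF mat22_carrier])
next
  case (Cons b as)
  then show ?case by (simp add: assoc_mult_mat[of _ 2 2 _ 2 _ 2])
qed

lemma cont_mat_Cons_index:
  "cont_mat (a # as) $$ (0, 0) = a * cont_mat as $$ (0, 0) + cont_mat as $$ (0, 1)"
  "cont_mat (a # as) $$ (0, 1) = - (cont_mat as $$ (0, 0))"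
  by (rule mat22_cases[OF cont_mat_carrier, of as], simp add: mult.commute)+

definition continuant_mat :: "'a::comm_ring_1 list \<Rightarrow> 'a mat" where
  "continuant_mat as = mat (length as) (length as)
     (\<lambda>(i, j). if i = j then as ! i else if i = Suc j \<or> j = Suc i then 1 else 0)"

lemma continuant_eq_det: "continuant as = det (continuant_mat as)"
  by (simp add: continuant_def continuant_mat_def)

lemma continuant_Nil: "continuant [] = 1"
  by (simp add: continuant_def)

lemma continuant_single: "continuant [a] = a"
  by (simp add: continuant_def det_single)

lemma det_continuant_mat_minor_10:
  "det (mat_delete (continuant_mat (a # b # as)) 1 0) = continuant as"
proof -
  let ?B = "mat_delete (continuant_mat (a # b # as)) 1 0"
  have "?B \<in> carrier_mat (Suc (length as)) (Suc (length as))"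
    by (rule carrier_matI) (simp_all add: continuant_mat_def mat_delete_def)
  then have "det ?B = (\<Sum>j<Suc (length as). ?B $$ (0, j) * cofactor ?B 0 j)"
    by (rule laplace_expansion_row) simp
  also have "\<dots> = cofactor ?B 0 0"
    unfolding sum.lessThan_Suc_shift by (simp add: continuant_mat_def mat_delete_def)
  also have "\<dots> = det (mat_delete ?B 0 0)"
    by (simp add: cofactor_def)
  also have "mat_delete ?B 0 0 = continuant_mat as"
    by (rule eq_matI) (auto simp: continuant_mat_def mat_delete_def)
  finally show ?thesis by (simp add: continuant_eq_det)
qed

lemma continuant_Cons_Cons:
  "continuant (a # b # as) = a * continuant (b # as) - continuant as"
proof -
  let ?A = "continuant_mat (a # b # as)" and ?n = "length as"
  have minor_00: "mat_delete ?A 0 0 = continuant_mat (b # as)"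
    by (rule eq_matI) (auto simp: continuant_mat_def mat_delete_def)
  have "?A \<in> carrier_mat (Suc (Suc ?n)) (Suc (Suc ?n))"
    by (simp add: continuant_mat_def)
  then have "det ?A = (\<Sum>i<Suc (Suc ?n). ?A $$ (i, 0) * cofactor ?A i 0)"
    by (rule laplace_expansion_column) simp
  also have "\<dots> = a * cofactor ?A 0 0 + cofactor ?A 1 0"
    unfolding sum.lessThan_Suc_shift by (simp add: continuant_mat_def)
  also have "\<dots> = a * continuant (b # as) - continuant as"
    using det_continuant_mat_minor_10[of a b as]
    by (simp add: cofactor_def minor_00 continuant_eq_det)
  finally show ?thesis by (simp add: continuant_eq_det)
qed

lemma cont_mat_index_00: "cont_mat as $$ (0, 0) = continuant as"
proof (induction as rule: induct_list012)
  case (2 a)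
  show ?case by (subst cont_mat_Cons_index) (simp add: continuant_single)
next
  case (3 a b as)
  have "cont_mat (a # b # as) $$ (0, 0) =
      a * cont_mat (b # as) $$ (0, 0) - cont_mat as $$ (0, 0)"
    by (simp only: cont_mat_Cons_index diff_conv_add_uminus)
  then show ?case by (simp only: 3 continuant_Cons_Cons)
qed (simp add: continuant_Nil)

lemma continuant_Cons: "continuant (a # as) = a * continuant as + cont_mat as $$ (0, 1)"
  using cont_mat_Cons_index(1)[of a as] unfolding cont_mat_index_00 .

lemma continuant_Cons_comaximal:
  obtains x y where "continuant (a # as) * x + continuant as * y = 1"
proof -
  obtain p q r s where M: "cont_mat (a # as) = mat22 p q r s"
    using mat22_cases[OF cont_mat_carrier] by blast
  have "p = continuant (a # as)" "q = - continuant as"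
    using cont_mat_index_00[of "a # as"] cont_mat_Cons_index(2)[of a as]
    unfolding M cont_mat_index_00 by simp_all
  then have "continuant (a # as) * s + continuant as * r = 1"
    using det_cont_mat[of "a # as"] unfolding M det_mat22 by simp
  then show thesis by (rule that)
qed

lemma local_ring_continuant_tl_unit:
  fixes as :: "'a::comm_ring_1 list"
  assumes local: "local_ring TYPE('a)" and nonunit: "\<not> continuant (a # as) dvd 1"
  shows "continuant as dvd 1"
proof (rule ccontr)
  assume "\<not> continuant as dvd 1"
  obtain x y where xy: "continuant (a # as) * x + continuant as * y = 1"
    by (rule continuant_Cons_comaximal)
  have "\<not> continuant (a # as) * x dvd 1" "\<not> continuant as * y dvd 1"
    using nonunit \<open>\<not> continuant as dvd 1\<close> dvd_mult_left by blast+
  then have "\<not> continuant (a # as) * x + continuant as * y dvd 1"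
    by (rule local_ring_nonunits_add[OF local])
  then show False by (simp add: xy)
qed

lemma mat22_completion_eq_diag_iff:
  fixes u :: "'a::comm_ring_1"
  assumes det: "p * s - q * r = 1" and uv: "u * v = 1"
  shows "mat22 c (- 1) 1 0 * mat22 p q r s * mat22 a (- 1) 1 0 = mat22 u 0 0 v \<longleftrightarrow>
    p = - v \<and> a = q * u \<and> c = - (r * u)"
    (is "?L \<longleftrightarrow> ?R")
proof -
  have "?L \<longleftrightarrow> - p = v \<and> q = - (p * a) \<and> r = c * p \<and> s = c * q - u"
    by (auto simp: algebra_simps eq_neg_iff_add_eq_0)
  also have "\<dots> \<longleftrightarrow> p = - v \<and> q = a * v \<and> r = - (c * v) \<and> s = c * q - u"
    by (auto simp: mult.commute)
  also have "\<dots> \<longleftrightarrow> p = - v \<and> q = a * v \<and> r = - (c * v)"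
  proof -
    have "s = c * q - u" if p: "p = - v" and r: "r = - (c * v)"
    proof -
      have "s = (u * v) * s" by (simp add: uv)
      also have "\<dots> = - u * (p * s)" by (simp add: p ac_simps)
      also have "p * s = 1 + q * r" using det by (simp add: algebra_simps)
      also have "- u * (1 + q * r) = c * q * (u * v) - u" by (simp add: r algebra_simps)
      finally show ?thesis by (simp add: uv)
    qed
    then show ?thesis by blast
  qed
  also have "\<dots> \<longleftrightarrow> ?R"
    using unit_mult_eq_iff[OF uv, of q a] unit_mult_eq_iff[OF uv, of "- r" c] by auto
  finally show ?thesis .
qed

lemma cont_mat_eq_diag_iff:
  fixes u :: "'a::comm_ring_1"
  assumes u: "u dvd 1"
  shows "cont_mat (a # bs @ [c]) = mat22 u 0 0 (unit_inv u) \<longleftrightarrow>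
    continuant bs = - unit_inv u \<and> a = cont_mat bs $$ (0, 1) * u \<and> c = - (cont_mat bs $$ (1, 0) * u)"
proof -
  obtain p q r s where M: "cont_mat bs = mat22 p q r s"
    using mat22_cases[OF cont_mat_carrier] by blast
  have det: "p * s - q * r = 1"
    using det_cont_mat[of bs] unfolding M det_mat22 .
  show ?thesis
    using mat22_completion_eq_diag_iff[OF det unit_inv_right[OF u], of c a]
    unfolding cont_mat.simps cont_mat_snoc cont_mat_index_00[symmetric] M
    by (simp del: mat22_mult mat22_eq_iff)
qed

section \<open>Sizes of the fibres\<close>

lemma finite_tuples [simp]: "finite (tuples n :: 'a::finite list set)"
  using finite_lists_length_eq[of "UNIV :: 'a set" n] by (simp add: tuples_def)

lemma card_tuples: "card (tuples n :: 'a::finite list set) = CARD('a) ^ n"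
  using card_lists_length_eq[of "UNIV :: 'a set" n] by (simp add: tuples_def)

lemma sum_card_continuant_fibre:
  "(\<Sum>x\<in>UNIV. card (continuant_fibre n (x::'a::{comm_ring_1, finite}))) = CARD('a) ^ n"
  using sum.group[of "tuples n" "UNIV :: 'a set" continuant "\<lambda>_. 1::nat"]
  by (simp add: continuant_fibre_def card_tuples)

lemma card_continuant_fibre_nonunit:
  fixes x :: "'a::comm_ring_1"
  assumes local: "local_ring TYPE('a)" and x: "\<not> x dvd 1"
  shows "card (continuant_fibre (Suc n) x) = card {as \<in> tuples n. continuant as dvd (1::'a)}"
proof -
  define ext where "ext as = (x - cont_mat as $$ (0, 1)) * unit_inv (continuant as) # as" for as
  have ext_iff: "continuant (a # as) = x \<longleftrightarrow> a # as = ext as" if "continuant as dvd 1" for a as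
    using unit_mult_eq_iff[OF unit_inv_right[OF that], of a "x - cont_mat as $$ (0, 1)"]
    by (auto simp: continuant_Cons ext_def eq_diff_eq)
  have "continuant_fibre (Suc n) x = ext ` {as \<in> tuples n. continuant as dvd 1}"
  proof (intro equalityI subsetI)
    fix as assume "as \<in> continuant_fibre (Suc n) x"
    then obtain b bs where bs: "as = b # bs" "length bs = n" "continuant (b # bs) = x"
      by (auto simp: continuant_fibre_def tuples_def length_Suc_conv)
    moreover from this have "continuant bs dvd 1"
      using local_ring_continuant_tl_unit[OF local] x by blast
    ultimately show "as \<in> ext ` {as \<in> tuples n. continuant as dvd 1}"
      using ext_iff by (auto simp: tuples_def)
  next
    fix as assume "as \<in> ext ` {as \<in> tuples n. continuant as dvd 1}"
    then show "as \<in> continuant_fibre (Suc n) x"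
      using ext_iff by (auto simp: continuant_fibre_def tuples_def ext_def)
  qed
  moreover have "inj_on ext A" for A
    by (rule inj_onI) (simp add: ext_def)
  ultimately show ?thesis by (simp add: card_image)
qed

lemma card_continuant_fibre_nonunit_eq_num_roots:
  fixes x :: "'a::comm_ring_1"
  assumes "local_ring TYPE('a)" "n \<ge> 1" "\<not> x dvd 1"
  shows "card (continuant_fibre n x) = num_roots TYPE('a) n"
  using assms by (cases n) (simp_all add: num_roots_def card_continuant_fibre_nonunit)

lemma num_diag_eq_card_continuant_fibre:
  fixes u :: "'a::comm_ring_1"
  assumes u: "u dvd 1"
  shows "num_diag (n + 2) u = card (continuant_fibre n (- unit_inv u))"
proof -
  define ext where "ext bs =
    cont_mat bs $$ (0, 1) * u # bs @ [- (cont_mat bs $$ (1, 0) * u)]" for bs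
  have ext_iff: "cont_mat (a # bs @ [c]) = mat22 u 0 0 (unit_inv u) \<longleftrightarrow>
    continuant bs = - unit_inv u \<and> a # bs @ [c] = ext bs" for a bs c
    unfolding cont_mat_eq_diag_iff[OF u] ext_def by simp
  have "{as \<in> tuples (n + 2). cont_mat as = mat22 u 0 0 (unit_inv u)} =
      ext ` continuant_fibre n (- unit_inv u)"
  proof (intro equalityI subsetI)
    fix as assume as: "as \<in> {as \<in> tuples (n + 2). cont_mat as = mat22 u 0 0 (unit_inv u)}"
    then obtain a cs where "as = a # cs" "length cs = Suc n"
      by (auto simp: tuples_def length_Suc_conv)
    then obtain bs c where "as = a # bs @ [c]" "length bs = n"
      by (auto simp: length_Suc_conv_rev)
    then show "as \<in> ext ` continuant_fibre n (- unit_inv u)"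
      using as ext_iff[of a bs c] by (auto simp: continuant_fibre_def tuples_def)
  next
    fix as assume "as \<in> ext ` continuant_fibre n (- unit_inv u)"
    then show "as \<in> {as \<in> tuples (n + 2). cont_mat as = mat22 u 0 0 (unit_inv u)}"
      using ext_iff by (auto simp: continuant_fibre_def tuples_def ext_def simp del: cont_mat.simps)
  qed
  moreover have "inj_on ext A" for A
    by (rule inj_onI) (simp add: ext_def)
  ultimately show ?thesis by (simp add: num_diag_def card_image)
qed

lemma sum_num_diag_eq_sum_card_continuant_fibre:
  "(\<Sum>u\<in>(unit_group :: 'a::comm_ring_1 set). num_diag (n + 2) u) =
    (\<Sum>u\<in>(unit_group :: 'a set). card (continuant_fibre n u))"
proof (rule sum.reindex_bij_witness[where i = "\<lambda>u. - unit_inv u" and j = "\<lambda>u. - unit_inv u"])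
  fix u :: 'a assume "u \<in> unit_group"
  then have u: "u dvd 1" by (simp add: unit_group_def)
  have inverse: "- unit_inv u * - u = 1"
    using unit_inv_right[OF u] by (simp add: mult.commute)
  show "- unit_inv (- unit_inv u) = u" "- unit_inv (- unit_inv u) = u"
    using unit_inv_unique[OF inverse] by simp_all
  show "- unit_inv u \<in> unit_group" "- unit_inv u \<in> unit_group"
    unfolding unit_group_def using inverse by (metis dvd_triv_left mem_Collect_eq)+
  show "card (continuant_fibre n (- unit_inv u)) = num_diag (n + 2) u"
    by (rule num_diag_eq_card_continuant_fibre[OF u, symmetric])
qed

lemma local_ring_card_power_eq:
  assumes "local_ring TYPE('a::{comm_ring_1, finite})" "n \<ge> 1"
  shows "CARD('a) ^ n =
    num_roots TYPE('a) n * card (UNIV - (unit_group :: 'a set)) +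
    (\<Sum>u\<in>(unit_group :: 'a set). num_diag (n + 2) u)"
proof -
  let ?U = "unit_group :: 'a set"
  have "CARD('a) ^ n =
      (\<Sum>x\<in>UNIV - ?U. card (continuant_fibre n x)) + (\<Sum>x\<in>?U. card (continuant_fibre n x))"
    unfolding sum_card_continuant_fibre[symmetric] by (rule sum.subset_diff) auto
  also have "(\<Sum>x\<in>UNIV - ?U. card (continuant_fibre n x)) =
      (\<Sum>x\<in>UNIV - ?U. num_roots TYPE('a) n)"
    by (rule sum.cong)
      (use assms in \<open>simp_all add: unit_group_def card_continuant_fibre_nonunit_eq_num_roots\<close>)
  finally show ?thesis
    unfolding sum_num_diag_eq_sum_card_continuant_fibre by (simp add: mult.commute)
qed

section \<open>Odd length\<close>

fun alternate_scale :: "'a::times \<Rightarrow> 'a \<Rightarrow> 'a list \<Rightarrow> 'a list" where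
  "alternate_scale u v [] = []"
| "alternate_scale u v (a # as) = u * a # alternate_scale v u as"

lemma length_alternate_scale [simp]: "length (alternate_scale u v as) = length as"
  by (induction u v as rule: alternate_scale.induct) auto

lemma alternate_scale_inverse:
  fixes u :: "'a::comm_monoid_mult"
  assumes "u * v = 1"
  shows "alternate_scale v u (alternate_scale u v as) = as"
  using assms
proof (induction u v as rule: alternate_scale.induct)
  case (2 u v a as)
  then have "v * u = 1" by (simp add: mult.commute)
  with 2 show ?case by (simp flip: mult.assoc)
qed simp

lemma continuant_alternate_scale:
  assumes "u * v = 1"
  shows "continuant (alternate_scale u v as) =
    (if even (length as) then 1 else u) * continuant as"
  using assms
proof (induction as arbitrary: u v rule: induct_list012)
  case (3 a b as)
  let ?e = "even (length as)"
  have vu: "v * u = 1" using "3.prems" by (simp add: mult.commute)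
  have "continuant (alternate_scale u v (a # b # as)) =
      u * a * continuant (alternate_scale v u (b # as)) - continuant (alternate_scale u v as)"
    by (simp add: continuant_Cons_Cons)
  also have "\<dots> = u * a * ((if ?e then v else 1) * continuant (b # as)) -
      (if ?e then 1 else u) * continuant as"
    using "3.IH"(2)[OF vu] "3.IH"(1)[OF "3.prems"] by simp
  also have "\<dots> = (if ?e then u * v else u) * (a * continuant (b # as)) -
      (if ?e then 1 else u) * continuant as"
    by (simp add: ac_simps)
  also have "\<dots> = (if ?e then 1 else u) * (a * continuant (b # as) - continuant as)"
    by (simp add: "3.prems" right_diff_distrib)
  finally show ?case by (simp add: continuant_Cons_Cons)
qed (simp_all add: continuant_Nil continuant_single)

lemma card_continuant_fibre_unit_mult:
  fixes u :: "'a::comm_ring_1"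
  assumes u: "u dvd 1" and n: "odd n"
  shows "card (continuant_fibre n (u * x)) = card (continuant_fibre n x)"
proof -
  obtain v where uv: "u * v = 1" and vu: "v * u = 1"
    using unit_inv_right[OF u] mult.commute by metis
  have "alternate_scale u v as \<in> continuant_fibre n (u * x)" if "as \<in> continuant_fibre n x" for as
    using that n by (simp add: continuant_fibre_def tuples_def continuant_alternate_scale[OF uv])
  moreover have "alternate_scale v u as \<in> continuant_fibre n x"
    if "as \<in> continuant_fibre n (u * x)" for as
    using that n vu by (simp add: continuant_fibre_def tuples_def continuant_alternate_scale[OF vu]
        flip: mult.assoc)
  ultimately have "bij_betw (alternate_scale u v) (continuant_fibre n x) (continuant_fibre n (u * x))"
    by (intro bij_betw_byWitness[where f' = "alternate_scale v u"])
      (auto simp: alternate_scale_inverse uv vu)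
  then show ?thesis by (metis bij_betw_same_card)
qed

lemma num_diag_odd:
  fixes u :: "'a::comm_ring_1"
  assumes u: "u dvd 1" and n: "odd n"
  shows "num_diag (n + 2) u = num_diag (n + 2) (1::'a)"
proof -
  have "unit_inv u dvd 1"
    using unit_inv_right[OF u] by (metis dvd_triv_right)
  have "num_diag (n + 2) u = card (continuant_fibre n (unit_inv u * - 1))"
    using num_diag_eq_card_continuant_fibre[OF u] by simp
  also have "\<dots> = card (continuant_fibre n (- 1 :: 'a))"
    using \<open>unit_inv u dvd 1\<close> n by (rule card_continuant_fibre_unit_mult)
  also have "\<dots> = num_diag (n + 2) (1::'a)"
    using num_diag_eq_card_continuant_fibre[of "1::'a" n] unit_inv_unique[of "1::'a" 1] by simp
  finally show ?thesis .
qed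

theorem theorem1p2:
  fixes n :: nat
  assumes "local_ring TYPE('a::{comm_ring_1, finite})"
    and "n \<ge> 1"
  shows "real (num_roots TYPE('a) n) =
           (real CARD('a) ^ n - (\<Sum>u\<in>(unit_group :: 'a set). real (num_diag (n + 2) u)))
             / real (card (UNIV - (unit_group :: 'a set))) \<and>
         (odd n \<longrightarrow> real (num_roots TYPE('a) n) =
           (real CARD('a) ^ n - real (card (unit_group :: 'a set)) * real (num_diag (n + 2) (1::'a)))
             / real (card (UNIV - (unit_group :: 'a set))))"
proof -
  let ?U = "unit_group :: 'a set"
  have "real CARD('a) ^ n = real (num_roots TYPE('a) n) * real (card (UNIV - ?U)) +
      (\<Sum>u\<in>?U. real (num_diag (n + 2) u))"
    using arg_cong[OF local_ring_card_power_eq[OF assms], of real] by simp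
  moreover have "card (UNIV - ?U) \<noteq> 0"
  proof -
    have "0 \<in> UNIV - ?U" by (simp add: unit_group_def)
    then show ?thesis by (auto simp del: Diff_iff)
  qed
  ultimately have "real (num_roots TYPE('a) n) =
      (real CARD('a) ^ n - (\<Sum>u\<in>?U. real (num_diag (n + 2) u))) / real (card (UNIV - ?U))"
    by (simp add: eq_divide_eq)
  moreover have "num_diag (n + 2) u = num_diag (n + 2) (1::'a)" if "odd n" "u \<in> ?U" for u
    using num_diag_odd[of u n] that by (simp add: unit_group_def)
  ultimately show ?thesis by simp
qed

end
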